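(* Let $\alpha>-\frac12$, let $1\le p\le\infty$, and put $a=\alpha+\frac12+\frac{1}{2\min\{2,p\}}$. Assume that $\psi:(0,+\infty)\to(0,+\infty)$ is a function with $\psi(r)\to 0$ as $r\to\infty$. Then there is no entire function $f$ that is frequently hypercyclic for the Dunkl operator $\Lambda_\alpha$ and satisfies $$M_p(f,r)\le\psi(r)\,\frac{e^r}{r^{a}}\quad\text{for all sufficiently large } r>0.$$
   Context: $H(\mathbb{C})$ is the vector space of all entire functions $\mathbb{C}\to\mathbb{C}$ with the topology of local uniform convergence (uniform convergence on compact sets). For $\alpha>-\frac12$, the Dunkl operator $\Lambda_\alpha:H(\mathbb{C})\to H(\mathbb{C})$ is the continuous linear operator given by $$\Lambda_\alpha f(z)=f'(z)+\frac{2\alpha+1}{z}\cdot\frac{f(z)-f(-z)}{2},$$ where the value at $z=0$ is understood by removing the singularity. The lower density of a set $A\subset\mathbb{N}=\{1,2,3,\dots\}$ is $\underline{\mathrm{dens}}(A)=\liminf_{N\to\infty}\frac{\#\{n\in A:\,n\le N\}}{N}$. A function $f\in H(\mathbb{C})$ is frequently hypercyclic for $\Lambda_\alpha$ if for every non-empty open set $U\subset H(\mathbb{C})$ one has $\underline{\mathrm{dens}}\{n\in\mathbb{N}:\Lambda_\alpha^n f\in U\}>0$. For an entire function $f$ and $r>0$, $M_p(f,r)=\Big(\frac{1}{2\pi}\int_0^{2\pi}|f(re^{it})|^p\,dt\Big)^{1/p}$ if $1\le p<\infty$, and $M_\infty(f,r)=\sup_{|z|=r}|f(z)|$. *)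

theory Defs
  imports "HOL-Complex_Analysis.Complex_Analysis"
begin

definition entire_functions :: "(complex \<Rightarrow> complex) set" where
  "entire_functions = {f. f holomorphic_on UNIV}"

definition entire_topology :: "(complex \<Rightarrow> complex) topology" where
  "entire_topology = topology (\<lambda>U. U \<subseteq> entire_functions \<and>
     (\<forall>f\<in>U. \<exists>K \<epsilon>. compact K \<and> \<epsilon> > 0 \<and>
        {g \<in> entire_functions. \<forall>z\<in>K. dist (g z) (f z) < \<epsilon>} \<subseteq> U))"

lemma openin_entire_topology:
  "openin entire_topology U \<longleftrightarrow> U \<subseteq> entire_functions \<and>
     (\<forall>f\<in>U. \<exists>K \<epsilon>. compact K \<and> \<epsilon> > 0 \<and>
        {g \<in> entire_functions. \<forall>z\<in>K. dist (g z) (f z) < \<epsilon>} \<subseteq> U)"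
proof -
  define B where "B f K \<epsilon> = {g \<in> entire_functions. \<forall>z\<in>K. dist (g z) (f z) < \<epsilon>}"
    for f :: "complex \<Rightarrow> complex" and K and \<epsilon> :: real
  define P where "P U \<longleftrightarrow> U \<subseteq> entire_functions \<and>
      (\<forall>f\<in>U. \<exists>K \<epsilon>. compact K \<and> \<epsilon> > 0 \<and> B f K \<epsilon> \<subseteq> U)" for U
  have B_mono: "B f K' d \<subseteq> B f K e" if "K \<subseteq> K'" "d \<le> e" for f K K' d e
    using that unfolding B_def by (auto intro: less_le_trans)
  have "P (S \<inter> T)" if S: "P S" and T: "P T" for S T
    unfolding P_def
  proof (intro conjI ballI)
    show "S \<inter> T \<subseteq> entire_functions" using S unfolding P_def by (auto dest: subsetD)
  next
    fix f assume f: "f \<in> S \<inter> T"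
    obtain K d where 1: "compact K" "d > 0" "B f K d \<subseteq> S"
      using S f unfolding P_def by (metis IntD1)
    obtain L e where 2: "compact L" "e > 0" "B f L e \<subseteq> T"
      using T f unfolding P_def by (metis IntD2)
    have "B f (K \<union> L) (min d e) \<subseteq> S"
      by (rule order_trans[OF B_mono 1(3)]) auto
    moreover have "B f (K \<union> L) (min d e) \<subseteq> T"
      by (rule order_trans[OF B_mono 2(3)]) auto
    ultimately have "compact (K \<union> L) \<and> min d e > 0 \<and> B f (K \<union> L) (min d e) \<subseteq> S \<inter> T"
      using 1 2 by (simp add: compact_Un)
    then show "\<exists>K \<epsilon>. compact K \<and> \<epsilon> > 0 \<and> B f K \<epsilon> \<subseteq> S \<inter> T" by (intro exI)
  qed
  moreover have "P (\<Union>\<U>)" if \<U>: "\<forall>S\<in>\<U>. P S" for \<U>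
    unfolding P_def
  proof (intro conjI ballI)
    show "\<Union>\<U> \<subseteq> entire_functions" using \<U> unfolding P_def by (simp add: Sup_le_iff)
  next
    fix f assume "f \<in> \<Union>\<U>"
    then obtain S where S: "S \<in> \<U>" "f \<in> S" by (rule UnionE)
    then obtain K e where "compact K" "e > 0" "B f K e \<subseteq> S"
      using \<U> unfolding P_def by metis
    then have "compact K \<and> e > 0 \<and> B f K e \<subseteq> \<Union>\<U>"
      using Union_upper[OF S(1)] by simp
    then show "\<exists>K \<epsilon>. compact K \<and> \<epsilon> > 0 \<and> B f K \<epsilon> \<subseteq> \<Union>\<U>" by (intro exI)
  qed
  ultimately have "istopology P"
    by (simp add: istopology_def)
  then have "openin (topology P) U = P U"
    by (simp add: topology_inverse')
  moreover have "entire_topology = topology P"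
    unfolding entire_topology_def P_def B_def by (rule refl)
  ultimately show ?thesis by (simp only: P_def B_def)
qed

lemma topspace_entire_topology: "topspace entire_topology = entire_functions"
proof -
  have "\<exists>K \<epsilon>. compact K \<and> \<epsilon> > 0 \<and>
      {g \<in> entire_functions. \<forall>z\<in>K. dist (g z) (f z) < \<epsilon>} \<subseteq> entire_functions" for f
    by (rule exI[of _ "{}"], rule exI[of _ "1::real"]) auto
  then have "openin entire_topology entire_functions"
    unfolding openin_entire_topology by blast
  then have "entire_functions \<subseteq> topspace entire_topology"
    by (rule openin_subset)
  moreover have "topspace entire_topology \<subseteq> entire_functions"
    using openin_topspace[of entire_topology] unfolding openin_entire_topology by (rule conjunct1)
  ultimately show ?thesis by (rule subset_antisym[rotated])
qed

definition dunkl :: "real \<Rightarrow> (complex \<Rightarrow> complex) \<Rightarrow> complex \<Rightarrow> complex" where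
  "dunkl \<alpha> f = remove_sings
     (\<lambda>z. deriv f z + of_real (2 * \<alpha> + 1) / z * ((f z - f (- z)) / 2))"

lemma dunkl_nonzero:
  assumes "f holomorphic_on UNIV" and "z \<noteq> 0"
  shows "dunkl \<alpha> f z = deriv f z + of_real (2 * \<alpha> + 1) / z * ((f z - f (- z)) / 2)"
proof -
  have f: "f analytic_on T" for T
    using assms(1) analytic_on_subset[OF _ subset_UNIV] by (simp add: analytic_on_open)
  have "(f \<circ> uminus) analytic_on {z}"
    by (rule analytic_on_compose[OF _ f]) (intro analytic_intros)
  then have "(\<lambda>z. f (- z)) analytic_on {z}" by (simp add: o_def)
  then show ?thesis
    unfolding dunkl_def using assms(2)
    using f[of "{z}"] analytic_deriv[OF f[of "{z}"]]
    by (intro remove_sings_at_analytic analytic_intros) auto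
qed

lemma dunkl_tendsto_0:
  assumes "f holomorphic_on UNIV"
  shows "(\<lambda>z. deriv f z + of_real (2 * \<alpha> + 1) / z * ((f z - f (- z)) / 2))
           \<midarrow>0\<rightarrow> of_real (2 * \<alpha> + 2) * deriv f 0"
proof -
  have d: "(f has_field_derivative deriv f z) (at z)" for z
    using assms holomorphic_derivI open_UNIV by blast
  have "((\<lambda>z. f z - f (- z)) has_field_derivative 2 * deriv f 0) (at 0)"
    using DERIV_diff[OF d[of 0] DERIV_chain2[of f "deriv f 0" "uminus" 0 "-1" UNIV]]
      d[of 0] DERIV_minus[OF DERIV_ident[of "at 0"]]
    by simp
  then have "(\<lambda>z. (f z - f (- z)) / z) \<midarrow>0\<rightarrow> 2 * deriv f 0"
    by (simp add: has_field_derivative_iff)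
  moreover have "deriv f \<midarrow>0\<rightarrow> deriv f 0"
    using holomorphic_deriv[OF assms open_UNIV]
    by (metis UNIV_I continuous_on_def holomorphic_on_imp_continuous_on)
  ultimately have "(\<lambda>z. deriv f z + of_real (2 * \<alpha> + 1) / 2 * ((f z - f (- z)) / z)) \<midarrow>0\<rightarrow>
      deriv f 0 + of_real (2 * \<alpha> + 1) / 2 * (2 * deriv f 0)"
    by (intro tendsto_intros)
  moreover have "deriv f 0 + of_real (2 * \<alpha> + 1) / 2 * (2 * deriv f 0) =
      of_real (2 * \<alpha> + 2) * deriv f 0"
    by (simp add: field_simps)
  ultimately show ?thesis by (simp add: mult.commute)
qed

lemma dunkl_0:
  assumes "f holomorphic_on UNIV"
  shows "dunkl \<alpha> f 0 = of_real (2 * \<alpha> + 2) * deriv f 0"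
  unfolding dunkl_def using dunkl_tendsto_0[OF assms] by (rule remove_sings_eqI)

lemma dunkl_entire:
  assumes "f holomorphic_on UNIV"
  shows "dunkl \<alpha> f holomorphic_on UNIV"
proof (rule no_isolated_singularity[where K = "{0}"])
  let ?g = "\<lambda>z. deriv f z + of_real (2 * \<alpha> + 1) / z * ((f z - f (- z)) / 2)"
  have "(f \<circ> uminus) holomorphic_on UNIV - {0}"
    by (rule holomorphic_on_compose[OF _ holomorphic_on_subset[OF assms subset_UNIV]])
      (intro holomorphic_intros)
  then have "(\<lambda>z. f (- z)) holomorphic_on UNIV - {0}" by (simp add: o_def)
  then have "?g holomorphic_on UNIV - {0}"
    using holomorphic_on_subset[OF assms subset_UNIV]
      holomorphic_on_subset[OF holomorphic_deriv[OF assms open_UNIV] subset_UNIV]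
    by (intro holomorphic_intros) auto
  then show *: "dunkl \<alpha> f holomorphic_on UNIV - {0}"
    by (rule holomorphic_transform) (simp add: dunkl_nonzero[OF assms])
  have "isCont (dunkl \<alpha> f) z" for z
  proof (cases "z = 0")
    case True
    have "dunkl \<alpha> f \<midarrow>0\<rightarrow> dunkl \<alpha> f 0"
      unfolding dunkl_0[OF assms]
      using dunkl_tendsto_0[OF assms] by (rule Lim_transform_eventually)
        (auto simp: eventually_at_filter dunkl_nonzero[OF assms])
    then show ?thesis using True by (simp add: isCont_def)
  next
    case False
    moreover have "open (UNIV - {0::complex})" by auto
    ultimately show ?thesis
      using holomorphic_on_imp_continuous_on[OF *] by (simp add: continuous_on_eq_continuous_at)
  qed
  then show "continuous_on UNIV (dunkl \<alpha> f)"
    by (simp add: continuous_at_imp_continuous_on)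
qed auto

definition lower_density :: "nat set \<Rightarrow> ereal" where
  "lower_density A = liminf (\<lambda>N. ereal (real (card (A \<inter> {1..N})) / real N))"

definition frequently_hypercyclic :: "'a topology \<Rightarrow> ('a \<Rightarrow> 'a) \<Rightarrow> 'a \<Rightarrow> bool" where
  "frequently_hypercyclic X T x \<longleftrightarrow> x \<in> topspace X \<and>
     (\<forall>U. openin X U \<longrightarrow> U \<noteq> {} \<longrightarrow> lower_density {n. n \<ge> 1 \<and> (T ^^ n) x \<in> U} > 0)"

definition integral_mean :: "ereal \<Rightarrow> (complex \<Rightarrow> complex) \<Rightarrow> real \<Rightarrow> real" where
  "integral_mean p f r =
     (if p = \<infinity> then SUP z\<in>sphere 0 r. cmod (f z)
      else (1 / (2 * pi) * integral {0..2 * pi}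
              (\<lambda>t. cmod (f (of_real r * exp (\<i> * of_real t))) powr real_of_ereal p))
            powr (1 / real_of_ereal p))"

end

theory Submission
  imports Defs
begin

text \<open>Write \<open>f = \<Sum> c\<^sub>n z\<^sup>n\<close>. Since \<open>\<Lambda>\<^sup>n f (0) = b\<^sub>n c\<^sub>n\<close> for a generalised factorial \<open>b\<^sub>n\<close> of
  order at most \<open>n! n powr (\<alpha> + 1/2)\<close>, frequent hypercyclicity makes \<open>\<bar>c\<^sub>n\<bar> > 1 / b\<^sub>n\<close> on a set
  of positive lower density. By pigeonhole there are arbitrarily large \<open>s\<close> for which a window of
  length of order \<open>sqrt s\<close> to the right of \<open>s\<close> contains a number \<open>m\<close> of order \<open>sqrt s\<close> of such
  \<open>n\<close>, and there \<open>\<bar>c\<^sub>n\<bar> s\<^sup>n \<ge> \<kappa>\<close> with \<open>\<kappa>\<close> of order \<open>exp s / s powr (\<alpha> + 1)\<close>. Testing \<open>f\<close>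
  against a trigonometric polynomial with these \<open>m\<close> frequencies and unimodular coefficients gives
  \<open>M\<^sub>p(f, s) \<ge> \<kappa> m powr (1 - 1 / min 2 p) / 2\<close>, which is of order \<open>exp s / s powr a\<close>, so \<open>\<psi>\<close>
  cannot tend to \<open>0\<close>.\<close>

unbundle no vec_syntax

section \<open>Action of the Dunkl operator on Taylor coefficients\<close>

definition dunkl_weight :: "real \<Rightarrow> nat \<Rightarrow> real" where
  "dunkl_weight \<alpha> n = real n + (if odd n then 2 * \<alpha> + 1 else 0)"

text \<open>The operator maps \<open>z ^ j\<close> to
  \<open>dunkl_weight \<alpha> j * z ^ (j - 1)\<close>, because its difference part vanishes on even
  powers. The product of these factors is the \<open>b\<^sub>n\<close> of the overview; at
  \<open>\<alpha> = - 1 / 2\<close> it would be the ordinary factorial.\<close>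

definition dunkl_fact :: "real \<Rightarrow> nat \<Rightarrow> real" where
  "dunkl_fact \<alpha> n = (\<Prod>j=1..n. dunkl_weight \<alpha> j)"

lemma dunkl_fact_0 [simp]: "dunkl_fact \<alpha> 0 = 1"
  and dunkl_fact_Suc [simp]: "dunkl_fact \<alpha> (Suc n) = dunkl_fact \<alpha> n * dunkl_weight \<alpha> (Suc n)"
  by (simp_all add: dunkl_fact_def)

text \<open>Multiplying by \<open>z\<close> removes the singularity, so both sides become power
  series identities valid at the origin as well. Substituting \<open>- z\<close> flips the sign of
  the odd coefficients, whence the parity in the weight.\<close>

lemma fps_nth_dunkl:
  assumes "f holomorphic_on UNIV"
  shows "fps_expansion (dunkl \<alpha> f) 0 $ n =
    of_real (dunkl_weight \<alpha> (Suc n)) * fps_expansion f 0 $ Suc n"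
proof -
  have f: "f has_fps_expansion fps_expansion f 0"
    by (rule has_fps_expansion_fps_expansion[OF open_UNIV _ assms]) simp
  have minus: "uminus has_fps_expansion - (fps_X :: complex fps)"
    using has_fps_expansion_minus[OF has_fps_expansion_fps_X] .
  have "(f \<circ> uminus) has_fps_expansion fps_compose (fps_expansion f 0) (- fps_X)"
    by (rule has_fps_expansion_compose[OF f minus]) simp
  then have refl: "(\<lambda>z. f (- z)) has_fps_expansion fps_compose (fps_expansion f 0) (- fps_X)"
    by (simp add: o_def)
  have "dunkl \<alpha> f has_fps_expansion fps_expansion (dunkl \<alpha> f) 0"
    by (rule has_fps_expansion_fps_expansion[OF open_UNIV _ dunkl_entire[OF assms]]) simp
  then have "(\<lambda>z. z * dunkl \<alpha> f z) has_fps_expansion fps_X * fps_expansion (dunkl \<alpha> f) 0"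
    by (intro has_fps_expansion_mult has_fps_expansion_fps_X)
  moreover have "(\<lambda>z. z * deriv f z + of_real (2 * \<alpha> + 1) / 2 * (f z - f (- z)))
      has_fps_expansion fps_X * fps_deriv (fps_expansion f 0)
        + fps_const (of_real (2 * \<alpha> + 1) / 2)
          * (fps_expansion f 0 - fps_compose (fps_expansion f 0) (- fps_X))"
    by (intro has_fps_expansion_add has_fps_expansion_mult has_fps_expansion_fps_X
        has_fps_expansion_deriv has_fps_expansion_cmult_left has_fps_expansion_diff f refl)
  moreover have "(\<lambda>z. z * dunkl \<alpha> f z) =
      (\<lambda>z. z * deriv f z + of_real (2 * \<alpha> + 1) / 2 * (f z - f (- z)))"
  proof
    fix z show "z * dunkl \<alpha> f z =
        z * deriv f z + of_real (2 * \<alpha> + 1) / 2 * (f z - f (- z))"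
      by (cases "z = 0") (simp_all add: dunkl_nonzero[OF assms] field_simps)
  qed
  ultimately have "fps_X * fps_expansion (dunkl \<alpha> f) 0 =
      fps_X * fps_deriv (fps_expansion f 0) + fps_const (of_real (2 * \<alpha> + 1) / 2)
        * (fps_expansion f 0 - fps_compose (fps_expansion f 0) (- fps_X))"
    by (metis fps_expansion_unique_complex)
  then have "(fps_X * fps_expansion (dunkl \<alpha> f) 0) $ Suc n =
      (fps_X * fps_deriv (fps_expansion f 0) + fps_const (of_real (2 * \<alpha> + 1) / 2)
        * (fps_expansion f 0 - fps_compose (fps_expansion f 0) (- fps_X))) $ Suc n"
    by simp
  then have eq: "fps_expansion (dunkl \<alpha> f) 0 $ n = of_nat (Suc n) * fps_expansion f 0 $ Suc n +
      of_real (2 * \<alpha> + 1) / 2 *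
        (fps_expansion f 0 $ Suc n - (- 1) ^ Suc n * fps_expansion f 0 $ Suc n)"
    by (simp add: fps_compose_uminus')
  show ?thesis
    by (cases "even n") (simp_all add: eq dunkl_weight_def algebra_simps)
qed

lemma dunkl_funpow_entire:
  assumes "f holomorphic_on UNIV"
  shows "(dunkl \<alpha> ^^ n) f holomorphic_on UNIV"
  by (induction n) (use assms in \<open>auto intro: dunkl_entire\<close>)

text \<open>Each application shifts the index by one and brings in one weight. Carrying
  \<open>dunkl_fact \<alpha> k\<close> on the left lets the weights telescope without any
  division.\<close>

lemma fps_nth_dunkl_funpow:
  assumes "f holomorphic_on UNIV"
  shows "of_real (dunkl_fact \<alpha> k) * fps_expansion ((dunkl \<alpha> ^^ n) f) 0 $ k =
    of_real (dunkl_fact \<alpha> (k + n)) * fps_expansion f 0 $ (k + n)"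
proof (induction n arbitrary: k)
  case (Suc n)
  have "of_real (dunkl_fact \<alpha> k) * fps_expansion ((dunkl \<alpha> ^^ Suc n) f) 0 $ k =
     of_real (dunkl_fact \<alpha> (Suc k)) * fps_expansion ((dunkl \<alpha> ^^ n) f) 0 $ Suc k"
    by (simp add: fps_nth_dunkl[OF dunkl_funpow_entire[OF assms]])
  also have "\<dots> = of_real (dunkl_fact \<alpha> (k + Suc n)) * fps_expansion f 0 $ (k + Suc n)"
    using Suc.IH[of "Suc k"] by simp
  finally show ?case .
qed simp

lemma dunkl_funpow_0:
  assumes "f holomorphic_on UNIV"
  shows "(dunkl \<alpha> ^^ n) f 0 = of_real (dunkl_fact \<alpha> n) * fps_expansion f 0 $ n"
  using fps_nth_dunkl_funpow[OF assms, of \<alpha> 0 n] by (simp add: fps_expansion_def)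

section \<open>Growth of the generalised factorial\<close>

lemma ln_fact_le: "n \<ge> 1 \<Longrightarrow> ln (fact n :: real) \<le> (real n + 1 / 2) * ln (real n) - real n + 1"
proof (induction n rule: dec_induct)
  case (step n)
  \<comment> \<open>The midpoint bound for the integral of \<open>1 / x\<close> over
    \<open>[n, n + 1]\<close>; it is exactly what the increment of the Stirling bound
    requires.\<close>
  have "2 / (2 * real n + 1) \<le> ln (real n + 1) - ln (real n)"
    using ln_inverse_approx_ge[of "real n" "real n + 1"] step by (simp add: algebra_simps)
  then have "1 \<le> (real n + 1 / 2) * (ln (real n + 1) - ln (real n))"
    by (simp add: field_simps)
  moreover have "ln (fact (Suc n) :: real) = ln (real n + 1) + ln (fact n)"
    using ln_mult[of "real n + 1" "fact n"] by (simp add: add.commute)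
  ultimately show ?case using step.IH by (simp add: algebra_simps)
qed simp

lemma dunkl_weight_pos:
  assumes "\<alpha> > - 1 / 2" "n \<ge> 1"
  shows "dunkl_weight \<alpha> n > 0"
  using assms by (auto simp: dunkl_weight_def intro: add_pos_pos)

lemma dunkl_fact_pos:
  assumes "\<alpha> > - 1 / 2"
  shows "dunkl_fact \<alpha> n > 0"
  unfolding dunkl_fact_def using dunkl_weight_pos[OF assms] by (intro prod_pos) auto

text \<open>With \<open>\<beta> = 2 * \<alpha> + 1\<close>, only every second factor of the
  factorial is enlarged, by \<open>\<beta>\<close>. Steps of two therefore cost
  \<open>1 + \<beta> / (m + 1) \<le> ((m + 2) / m) powr (\<beta> / 2)\<close> each, and these costs
  telescope to a power of exponent \<open>\<beta> / 2\<close>; the base cases account for the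
  constant \<open>exp \<beta>\<close>.\<close>

lemma dunkl_fact_le_fact:
  assumes "\<alpha> > - 1 / 2" "n \<ge> 1"
  shows "dunkl_fact \<alpha> n \<le> fact n * exp ((2 * \<alpha> + 1) * (1 + ln (real n) / 2))"
  using assms(2)
proof (induction n rule: less_induct)
  case (less n)
  define \<beta> where "\<beta> = 2 * \<alpha> + 1"
  have \<beta>: "\<beta> > 0" using assms(1) by (simp add: \<beta>_def)
  consider "n = 1" | "n = 2" | m where "m \<ge> 1" "n = Suc (Suc m)"
    using less.prems by (metis One_nat_def Suc_1 less_eq_Suc_le less_one linorder_not_less nat.exhaust)
  then show ?case
  proof cases
    case 1
    then show ?thesis
      using exp_ge_add_one_self[of \<beta>] by (simp add: dunkl_fact_def dunkl_weight_def \<beta>_def)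
  next
    case 2
    have "1 + \<beta> \<le> exp \<beta>" by (rule exp_ge_add_one_self)
    also have "\<dots> \<le> exp (\<beta> * (1 + ln 2 / 2))" using \<beta> by simp
    finally have "1 + \<beta> \<le> exp (\<beta> * (1 + ln 2 / 2))" .
    moreover have "dunkl_fact \<alpha> n = 2 * (1 + \<beta>)"
      using 2 by (simp add: dunkl_fact_def dunkl_weight_def \<beta>_def numeral_2_eq_2 atLeastAtMostSuc_conv)
    ultimately show ?thesis
      using 2 by (simp add: \<beta>_def)
  next
    case 3
    have "4 / (2 * real m + 2) \<le> ln (real m + 2) - ln (real m)"
      using ln_inverse_approx_ge[of "real m" "real m + 2"] 3 by (simp add: algebra_simps)
    then have "\<beta> * (1 / (real m + 1)) \<le> \<beta> * ((ln (real m + 2) - ln (real m)) / 2)"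
      using \<beta> by (intro mult_left_mono) (auto simp: field_simps)
    then have "exp (\<beta> / (real m + 1)) \<le> exp (\<beta> * ((ln (real m + 2) - ln (real m)) / 2))"
      by (subst exp_le_cancel_iff) simp
    then have *: "1 + \<beta> / (real m + 1) \<le> exp (\<beta> * ((ln (real m + 2) - ln (real m)) / 2))"
      by (rule order_trans[OF exp_ge_add_one_self])
    \<comment> \<open>Exactly one of the two indices is odd; the product is larger when it is the
      smaller index.\<close>
    have "dunkl_weight \<alpha> (Suc m) * dunkl_weight \<alpha> (Suc (Suc m))
        \<le> (real m + 1 + \<beta>) * (real m + 2)"
      using \<beta> by (auto simp: dunkl_weight_def \<beta>_def algebra_simps)
    also have "\<dots> = (real m + 1) * (real m + 2) * (1 + \<beta> / (real m + 1))"
      by (simp add: field_simps)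
    also have "\<dots> \<le> (real m + 1) * (real m + 2) *
        exp (\<beta> * ((ln (real m + 2) - ln (real m)) / 2))"
      using * by (intro mult_left_mono) auto
    finally have W: "dunkl_weight \<alpha> (Suc m) * dunkl_weight \<alpha> (Suc (Suc m)) \<le>
        (real m + 1) * (real m + 2) * exp (\<beta> * ((ln (real m + 2) - ln (real m)) / 2))" .
    have "dunkl_fact \<alpha> m * (dunkl_weight \<alpha> (Suc m) * dunkl_weight \<alpha> (Suc (Suc m)))
       \<le> (fact m * exp (\<beta> * (1 + ln (real m) / 2))) * ((real m + 1) * (real m + 2) *
        exp (\<beta> * ((ln (real m + 2) - ln (real m)) / 2)))"
    proof (rule mult_mono[OF _ W])
      show "dunkl_fact \<alpha> m \<le> fact m * exp (\<beta> * (1 + ln (real m) / 2))"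
        using less.IH[of m] 3 by (auto simp: \<beta>_def Suc_le_eq)
      show "0 \<le> dunkl_weight \<alpha> (Suc m) * dunkl_weight \<alpha> (Suc (Suc m))"
        using dunkl_weight_pos[OF assms(1)] by (simp add: less_imp_le)
    qed simp_all
    also have "\<dots> = fact m * ((real m + 1) * (real m + 2)) * (exp (\<beta> * (1 + ln (real m) / 2)) *
        exp (\<beta> * ((ln (real m + 2) - ln (real m)) / 2)))"
      by (simp only: mult_ac)
    also have "exp (\<beta> * (1 + ln (real m) / 2)) * exp (\<beta> * ((ln (real m + 2) - ln (real m)) / 2))
       = exp (\<beta> * (1 + ln (real m + 2) / 2))"
      unfolding exp_add[symmetric] by (simp add: algebra_simps diff_divide_distrib)
    finally have "dunkl_fact \<alpha> m * (dunkl_weight \<alpha> (Suc m) * dunkl_weight \<alpha> (Suc (Suc m)))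
       \<le> fact m * ((real m + 1) * (real m + 2)) * exp (\<beta> * (1 + ln (real m + 2) / 2))" .
    moreover have "fact n = (fact m * ((real m + 1) * (real m + 2)) :: real)" "real n = real m + 2"
      using 3 by (simp_all add: algebra_simps)
    moreover have "dunkl_fact \<alpha> n =
        dunkl_fact \<alpha> m * (dunkl_weight \<alpha> (Suc m) * dunkl_weight \<alpha> (Suc (Suc m)))"
      using 3 by simp
    ultimately show ?thesis by (simp only: \<beta>_def)
  qed
qed

text \<open>Stirling contributes the exponent \<open>1 / 2\<close> and the odd weights contribute
  \<open>(2 * \<alpha> + 1) / 2\<close>, together \<open>\<alpha> + 1\<close>.\<close>

lemma dunkl_fact_le:
  assumes "\<alpha> > - 1 / 2" "n \<ge> 1"
  shows "dunkl_fact \<alpha> n \<le> exp (2 * \<alpha> + 2) * (real n ^ n * real n powr (\<alpha> + 1) / exp (real n))"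
proof -
  have "dunkl_fact \<alpha> n \<le> exp (ln (fact n)) * exp ((2 * \<alpha> + 1) * (1 + ln (real n) / 2))"
    using dunkl_fact_le_fact[OF assms] by simp
  also have "\<dots> \<le> exp ((real n + 1 / 2) * ln (real n) - real n + 1) *
      exp ((2 * \<alpha> + 1) * (1 + ln (real n) / 2))"
    using ln_fact_le[OF assms(2)] by (intro mult_right_mono iffD2[OF exp_le_cancel_iff]) auto
  also have "\<dots> = exp (2 * \<alpha> + 2 + real n * ln (real n) + (\<alpha> + 1) * ln (real n) - real n)"
    unfolding exp_add[symmetric] by (rule arg_cong[of _ _ exp]) (simp add: field_simps)
  also have "\<dots> = exp (2 * \<alpha> + 2) * (real n ^ n * real n powr (\<alpha> + 1) / exp (real n))"
    using assms(2) by (simp add: exp_add exp_diff powr_def exp_of_nat_mult)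
  finally show ?thesis .
qed

text \<open>Each of the \<open>k\<close> weights beyond \<open>s\<close> is at most
  \<open>s * (1 + (k + 2 * \<alpha> + 1) / s)\<close>. The resulting exponential stays bounded as
  long as \<open>k\<^sup>2\<close> is of order at most \<open>s\<close>.\<close>

lemma dunkl_fact_add_le:
  assumes "\<alpha> > - 1 / 2" "s \<ge> 1"
  shows "dunkl_fact \<alpha> (s + k) \<le>
    dunkl_fact \<alpha> s * real s ^ k * exp (real k * (real k + (2 * \<alpha> + 1)) / real s)"
proof -
  define \<beta> where "\<beta> = 2 * \<alpha> + 1"
  have \<beta>: "\<beta> > 0" using assms(1) by (simp add: \<beta>_def)
  have "j \<le> k \<Longrightarrow> dunkl_fact \<alpha> (s + j) \<le> dunkl_fact \<alpha> s * (real s + (real k + \<beta>)) ^ j" for j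
  proof (induction j)
    case (Suc j)
    have "dunkl_weight \<alpha> (Suc (s + j)) \<le> real s + (real k + \<beta>)"
      using Suc.prems \<beta> by (auto simp: dunkl_weight_def \<beta>_def)
    then have "dunkl_fact \<alpha> (s + j) * dunkl_weight \<alpha> (Suc (s + j)) \<le>
      dunkl_fact \<alpha> s * (real s + (real k + \<beta>)) ^ j * (real s + (real k + \<beta>))"
      using Suc \<beta> dunkl_weight_pos[OF assms(1), of "Suc (s+j)"] dunkl_fact_pos[OF assms(1), of s]
      by (intro mult_mono) auto
    then show ?case by (simp add: mult_ac)
  qed simp
  then have "dunkl_fact \<alpha> (s + k) \<le> dunkl_fact \<alpha> s * (real s + (real k + \<beta>)) ^ k" by simp
  also have "real s + (real k + \<beta>) = real s * (1 + (real k + \<beta>) / real s)"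
    using assms(2) by (simp add: field_simps)
  also have "dunkl_fact \<alpha> s * (real s * (1 + (real k + \<beta>) / real s)) ^ k \<le>
      dunkl_fact \<alpha> s * (real s * exp ((real k + \<beta>) / real s)) ^ k"
    using dunkl_fact_pos[OF assms(1), of s] \<beta>
    by (intro mult_left_mono power_mono) (auto simp: exp_ge_add_one_self)
  also have "\<dots> = dunkl_fact \<alpha> s * real s ^ k * exp (real k * (real k + \<beta>) / real s)"
    by (simp add: power_mult_distrib exp_of_nat_mult[symmetric])
  finally show ?thesis by (simp add: \<beta>_def)
qed

text \<open>Taking the radius equal to \<open>s\<close> makes the power \<open>s ^ (s + k)\<close>
  cancel against the upper bounds for the generalised factorial.\<close>

lemma power_div_dunkl_fact_ge:
  assumes "\<alpha> > - 1 / 2" "s \<ge> 1"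
  shows "real s ^ (s + k) / dunkl_fact \<alpha> (s + k) \<ge>
    exp (- (2 * \<alpha> + 2) - real k * (real k + (2 * \<alpha> + 1)) / real s) *
      (exp (real s) / real s powr (\<alpha> + 1))"
proof -
  define E where "E = real k * (real k + (2 * \<alpha> + 1)) / real s"
  have s: "real s > 0" using assms(2) by simp
  define K where "K = exp (2 * \<alpha> + 2)"
  have K: "K > 0" by (simp add: K_def)
  have exp_E: "exp (- x - E) = 1 / (exp x * exp E)" for x
    by (simp add: exp_diff exp_minus field_simps)
  have "dunkl_fact \<alpha> (s + k) \<le> dunkl_fact \<alpha> s * real s ^ k * exp E"
    using dunkl_fact_add_le[OF assms] by (simp add: E_def)
  also have "\<dots> \<le> exp (2 * \<alpha> + 2) * (real s ^ s * real s powr (\<alpha> + 1) / exp (real s))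
      * real s ^ k * exp E"
    using dunkl_fact_le[OF assms] by (intro mult_right_mono) auto
  also have "\<dots> = real s ^ (s + k) /
      (exp (- (2 * \<alpha> + 2) - E) * (exp (real s) / real s powr (\<alpha> + 1)))"
    using s K unfolding exp_E K_def[symmetric] by (simp add: power_add field_simps)
  finally show ?thesis
    using dunkl_fact_pos[OF assms(1), of "s + k"] s unfolding E_def
    by (simp add: field_simps)
qed

section \<open>Integral means and Taylor coefficients\<close>

lemma has_integral_circle_coeff:
  assumes f: "f holomorphic_on UNIV" and r: "r > 0"
  shows "((\<lambda>t. f (of_real r * cis t) * cis (- t) ^ n) has_integral
    2 * pi * (fps_expansion f 0 $ n * of_real r ^ n)) {0..2 * pi}"
proof -
  have "((\<lambda>u. f u / (u - 0) ^ Suc n) has_contour_integral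
      (2 * pi * \<i> / fact n * (deriv ^^ n) f 0)) (circlepath 0 r)"
    using r holomorphic_on_subset[OF f subset_UNIV]
    by (intro Cauchy_has_contour_integral_higher_derivative_circlepath)
      (auto intro: holomorphic_on_imp_continuous_on)
  then have "((\<lambda>t. f (of_real r * cis t) / (of_real r * cis t) ^ Suc n * of_real r * \<i> * cis t)
      has_integral 2 * pi * \<i> * (fps_expansion f 0 $ n)) {0..2 * pi}"
    unfolding circlepath_def
    by (subst (asm) has_contour_integral_part_circlepath_iff) (auto simp: fps_expansion_def)
  \<comment> \<open>The factor cancels the \<open>\<i>\<close> of the path derivative and the powers
    of \<open>r\<close> in Cauchy's formula.\<close>
  then have "((\<lambda>t. of_real r ^ n / \<i> *
      (f (of_real r * cis t) / (of_real r * cis t) ^ Suc n * of_real r * \<i> * cis t))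
      has_integral of_real r ^ n / \<i> * (2 * pi * \<i> * (fps_expansion f 0 $ n))) {0..2 * pi}"
    by (rule has_integral_mult_right)
  moreover have "of_real r ^ n / \<i> * (w / (of_real r * cis t) ^ Suc n * of_real r * \<i> * cis t)
      = w * cis (- t) ^ n" for w t
  proof -
    have "cis (- t) ^ n = inverse (cis t ^ n)"
      by (simp add: cis_inverse[symmetric] power_inverse del: cis_inverse)
    then show ?thesis using r by (simp add: power_mult_distrib field_simps)
  qed
  ultimately show ?thesis by (simp add: mult_ac)
qed

lemma fps_expansion_poly_sum:
  assumes "finite F"
  shows "fps_expansion (\<lambda>z. \<Sum>k\<in>F. \<sigma> k * z ^ k) 0 $ n = (if n \<in> F then \<sigma> n else (0::complex))"
proof -
  have "(\<lambda>z. \<Sum>k\<in>F. \<sigma> k * z ^ k) has_fps_expansion (\<Sum>k\<in>F. fps_const (\<sigma> k) * fps_X ^ k)"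
    by (intro has_fps_expansion_sum has_fps_expansion_cmult_left has_fps_expansion_fps_X_power)
  then have "fps_expansion (\<lambda>z. \<Sum>k\<in>F. \<sigma> k * z ^ k) 0 $ n =
      (\<Sum>k\<in>F. fps_const (\<sigma> k) * fps_X ^ k) $ n"
    by (simp add: fps_nth_fps_expansion fps_expansion_def)
  also have "\<dots> = (\<Sum>k\<in>F. if n = k then \<sigma> k else 0)"
    by (simp add: fps_sum_nth fps_X_power_nth if_distrib cong: if_cong)
  finally show ?thesis using assms by (simp add: sum.delta)
qed

text \<open>Needed twice: pairing the test polynomial with itself yields its mean square, pairing
  \<open>f\<close> with it yields the sum of the chosen coefficients.\<close>

lemma has_integral_circle_poly:
  assumes f: "f holomorphic_on UNIV" and r: "r > 0" and F: "finite F"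
  shows "((\<lambda>t. f (of_real r * cis t) * cnj (\<Sum>n\<in>F. \<sigma> n * cis t ^ n)) has_integral
    2 * pi * (\<Sum>n\<in>F. cnj (\<sigma> n) * (fps_expansion f 0 $ n * of_real r ^ n))) {0..2 * pi}"
proof -
  have "((\<lambda>t. \<Sum>n\<in>F. cnj (\<sigma> n) * (f (of_real r * cis t) * cis (- t) ^ n)) has_integral
    (\<Sum>n\<in>F. cnj (\<sigma> n) * (2 * pi * (fps_expansion f 0 $ n * of_real r ^ n)))) {0..2 * pi}"
    by (intro has_integral_sum F has_integral_mult_right has_integral_circle_coeff[OF f r])
  then show ?thesis
    by (simp add: sum_distrib_left mult_ac cis_cnj)
qed

text \<open>\<open>u\<close> is the modulus of a trigonometric polynomial with frequencies in \<open>F\<close> whose unimodular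
  coefficients have the signs of the Taylor coefficients of \<open>f\<close>.\<close>

lemma obtain_dual_function:
  assumes f: "f holomorphic_on UNIV" and r: "r > 0" and F: "finite F"
    and coeff: "\<And>n. n \<in> F \<Longrightarrow> \<kappa> \<le> cmod (fps_expansion f 0 $ n) * r ^ n"
  obtains u :: "real \<Rightarrow> real" where
    "continuous_on {0..2 * pi} u" "\<And>t. 0 \<le> u t" "\<And>t. u t \<le> real (card F)"
    "((\<lambda>t. (u t)\<^sup>2) has_integral 2 * pi * real (card F)) {0..2 * pi}"
    "2 * pi * (\<kappa> * real (card F)) \<le>
      integral {0..2 * pi} (\<lambda>t. cmod (f (of_real r * cis t)) * u t)"
proof -
  define c where "c n = fps_expansion f 0 $ n" for n
  \<comment> \<open>The value \<open>1\<close> at vanishing coefficients keeps every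
    \<open>\<sigma> n\<close> unimodular, so that the mean square below is exactly
    \<open>card F\<close>.\<close>
  define \<sigma> where "\<sigma> n = (if c n = 0 then 1 else sgn (c n))" for n
  have \<sigma>: "cmod (\<sigma> n) = 1" for n by (simp add: \<sigma>_def norm_sgn)
  have \<sigma>c: "cnj (\<sigma> n) * c n = of_real (cmod (c n))" for n
  proof (cases "c n = 0")
    case False
    have "cnj (\<sigma> n) * c n = c n * cnj (c n) / of_real (cmod (c n))"
      using False by (simp add: \<sigma>_def sgn_eq)
    then show ?thesis
      using False by (simp add: complex_norm_square[symmetric] power2_eq_square)
  qed simp
  define P where "P z = (\<Sum>n\<in>F. \<sigma> n * z ^ n)" for z
  define u where "u t = cmod (P (cis t))" for t
  have P: "P holomorphic_on UNIV"
    unfolding P_def by (intro holomorphic_intros)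
  have cont: "continuous_on {0..2 * pi} u"
    unfolding u_def P_def by (intro continuous_intros)
  have contf: "continuous_on {0..2 * pi} (\<lambda>t. f (of_real r * cis t))"
    by (rule continuous_on_compose2[OF holomorphic_on_imp_continuous_on[OF f]])
      (auto intro!: continuous_intros)
  have le: "u t \<le> real (card F)" for t
  proof -
    have "u t \<le> (\<Sum>n\<in>F. cmod (\<sigma> n * cis t ^ n))"
      unfolding u_def P_def by (rule norm_sum)
    then show ?thesis by (simp add: norm_mult norm_power \<sigma>)
  qed
  have "((\<lambda>t. P (of_real 1 * cis t) * cnj (P (cis t))) has_integral
    2 * pi * (\<Sum>n\<in>F. cnj (\<sigma> n) * (fps_expansion P 0 $ n * of_real 1 ^ n))) {0..2 * pi}"
    unfolding P_def[of "cis _"] by (rule has_integral_circle_poly[OF P _ F]) simp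
  moreover have "cnj (\<sigma> n) * (fps_expansion P 0 $ n * of_real 1 ^ n) = 1" if "n \<in> F" for n
    using that \<sigma>[of n] fps_expansion_poly_sum[OF F, of \<sigma> n]
    by (simp add: P_def[abs_def] mult.commute[of "cnj _"] complex_norm_square[symmetric])
  ultimately have "((\<lambda>t. of_real ((u t)\<^sup>2)) has_integral
      (of_real (2 * pi * real (card F)) :: complex)) {0..2 * pi}"
    by (simp add: u_def complex_norm_square del: of_real_power)
  then have "((\<lambda>t. Re (of_real ((u t)\<^sup>2))) has_integral
      Re (of_real (2 * pi * real (card F)) :: complex)) {0..2 * pi}"
    by (rule has_integral_Re)
  then have sq: "((\<lambda>t. (u t)\<^sup>2) has_integral 2 * pi * real (card F)) {0..2 * pi}"
    by simp
  have I: "((\<lambda>t. f (of_real r * cis t) * cnj (P (cis t))) has_integral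
    2 * pi * (\<Sum>n\<in>F. cnj (\<sigma> n) * (fps_expansion f 0 $ n * of_real r ^ n))) {0..2 * pi}"
    unfolding P_def[of "cis _"] by (rule has_integral_circle_poly[OF f r F])
  have S: "(\<Sum>n\<in>F. cnj (\<sigma> n) * (fps_expansion f 0 $ n * of_real r ^ n)) =
      of_real (\<Sum>n\<in>F. cmod (c n) * r ^ n)"
    using \<sigma>c by (simp add: c_def mult.assoc[symmetric])
  have "2 * pi * (\<kappa> * real (card F)) \<le> 2 * pi * (\<Sum>n\<in>F. cmod (c n) * r ^ n)"
    using sum_mono[of F "\<lambda>_. \<kappa>", OF coeff] by (simp add: c_def mult.commute)
  also have "\<dots> = Re (integral {0..2 * pi} (\<lambda>t. f (of_real r * cis t) * cnj (P (cis t))))"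
    using I unfolding S by (simp add: integral_unique)
  also have "\<dots> \<le> cmod (integral {0..2 * pi} (\<lambda>t. f (of_real r * cis t) * cnj (P (cis t))))"
    by (rule complex_Re_le_cmod)
  also have "\<dots> \<le> integral {0..2 * pi} (\<lambda>t. cmod (f (of_real r * cis t)) * u t)"
  proof (rule integral_norm_bound_integral)
    show "(\<lambda>t. f (of_real r * cis t) * cnj (P (cis t))) integrable_on {0..2 * pi}"
      using I by blast
    show "(\<lambda>t. cmod (f (of_real r * cis t)) * u t) integrable_on {0..2 * pi}"
      by (intro integrable_continuous_interval continuous_intros contf cont)
  qed (simp add: u_def norm_mult)
  finally show ?thesis
    using that[OF cont _ le sq] by (simp add: u_def)
qed

text \<open>The intended values are \<open>L = 2 * pi\<close>, \<open>h\<close> the modulus of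
  \<open>f\<close> on the circle divided by \<open>\<kappa>\<close>, \<open>u\<close> the modulus of
  the test polynomial and \<open>m\<close> the number of its frequencies.\<close>

context
  fixes h u :: "real \<Rightarrow> real" and L m :: real
  assumes h: "continuous_on {0..L} h" "\<And>t. 0 \<le> h t"
    and u: "continuous_on {0..L} u" "\<And>t. 0 \<le> u t" "\<And>t. u t \<le> m"
    and m: "m > 0"
    and sq: "((\<lambda>t. (u t)\<^sup>2) has_integral L * m) {0..L}"
    and prod: "L * m \<le> integral {0..L} (\<lambda>t. h t * u t)"
begin

lemma integrable_powr: "p > 0 \<Longrightarrow> (\<lambda>t. h t powr p) integrable_on {0..L}"
  using h by (intro integrable_continuous_interval continuous_on_powr') auto

lemma integrable_prod: "(\<lambda>t. h t * u t) integrable_on {0..L}"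
  using h u by (intro integrable_continuous_interval continuous_intros)

lemma integrable_square: "(\<lambda>t. (h t)\<^sup>2) integrable_on {0..L}"
  using h by (intro integrable_continuous_interval continuous_intros)

text \<open>Where \<open>h u > u\<^sup>2 / 2\<close> we have \<open>u \<le> 2 h\<close>, so that \<open>h u\<close> is controlled by \<open>h powr p\<close>;
  this replaces the Hausdorff--Young inequality.\<close>

lemma integral_powr_ge_small:
  assumes p: "1 \<le> p" "p \<le> 2"
  shows "L * (m powr (p - 1) / 2 powr p) \<le> integral {0..L} (\<lambda>t. h t powr p)"
proof -
  have ptw: "h t * u t \<le> (u t)\<^sup>2 / 2 + 2 powr (p - 1) * m powr (2 - p) * h t powr p" for t
  proof (cases "u t \<le> 2 * h t \<and> u t > 0")
    case True
    then have ht: "h t > 0" by linarith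
    \<comment> \<open>The last two factors are bounded through \<open>u t \<le> m\<close> and
      \<open>u t / h t \<le> 2\<close>, which explains the constant in the claim.\<close>
    have "h t * u t = h t powr p * u t powr (2 - p) * (u t / h t) powr (p - 1)"
      using True ht by (simp add: powr_divide powr_diff powr_add[symmetric] field_simps)
        (simp add: powr_add[symmetric] powr_minus powr_diff field_simps power2_eq_square)
    also have "\<dots> \<le> h t powr p * m powr (2 - p) * 2 powr (p - 1)"
      using True ht p u(3)[of t] by (intro mult_mono powr_mono2) (auto simp: field_simps)
    finally show ?thesis by (simp add: mult_ac add_increasing)
  next
    case False
    then have "h t * u t \<le> (u t)\<^sup>2 / 2"
    proof (cases "u t = 0")
      case False
      then have "2 * h t * u t \<le> u t * u t"
        using u(2)[of t] \<open>\<not> (u t \<le> 2 * h t \<and> u t > 0)\<close> by (intro mult_right_mono) auto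
      then show ?thesis by (simp add: power2_eq_square)
    qed simp
    then show ?thesis by (simp add: add_increasing2)
  qed
  have "L * m \<le> integral {0..L} (\<lambda>t. h t * u t)" by (rule prod)
  also have "\<dots> \<le> integral {0..L} (\<lambda>t. (u t)\<^sup>2 / 2 + 2 powr (p - 1) * m powr (2 - p) * h t powr p)"
    using ptw integrable_powr[of p] p sq
    by (intro integral_le integrable_prod integrable_add integrable_on_divide
      integrable_on_mult_right) auto
  also have "\<dots> = L * m / 2 + 2 powr (p - 1) * m powr (2 - p) * integral {0..L} (\<lambda>t. h t powr p)"
    using integrable_powr[of p] p sq
    by (subst integral_add) (auto simp: integral_unique[OF sq] intro!: integrable_on_divide integrable_on_mult_right)
  \<comment> \<open>The \<open>u\<close>-square term integrates to half of the left side and is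
    absorbed there.\<close>
  finally have "L * m / 2 \<le> 2 powr (p - 1) * m powr (2 - p) * integral {0..L} (\<lambda>t. h t powr p)"
    by simp
  then show ?thesis
    using m by (simp add: powr_diff field_simps power2_eq_square)
qed

text \<open>The arithmetic-geometric inequality suffices in place of Cauchy-Schwarz, because the
  integral of the square of \<open>u\<close> is known exactly.\<close>

lemma integral_square_ge: "L * m \<le> integral {0..L} (\<lambda>t. (h t)\<^sup>2)"
proof -
  have ptw: "h t * u t \<le> (u t)\<^sup>2 / 2 + (h t)\<^sup>2 / 2" for t
    using sum_squares_bound[of "h t" "u t"] by (simp add: field_simps)
  have "L * m \<le> integral {0..L} (\<lambda>t. h t * u t)" by (rule prod)
  also have "\<dots> \<le> integral {0..L} (\<lambda>t. (u t)\<^sup>2 / 2 + (h t)\<^sup>2 / 2)"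
    using ptw sq
    by (intro integral_le integrable_prod integrable_add integrable_on_divide integrable_square) auto
  also have "\<dots> = L * m / 2 + integral {0..L} (\<lambda>t. (h t)\<^sup>2) / 2"
    using sq integrable_square
    by (subst integral_add) (auto simp: integral_unique[OF sq] intro!: integrable_on_divide)
  finally show ?thesis by simp
qed

text \<open>Truncation takes the place of Jensen's inequality: points where the square of
  \<open>h\<close> is at most \<open>m / 2\<close> account for at most half of the quadratic bound,
  and elsewhere the square is dominated by a multiple of \<open>h t powr p\<close>.\<close>

lemma integral_powr_ge_large:
  assumes L: "L \<ge> 0" and p: "2 \<le> p"
  shows "L * (m / 2) powr (p / 2) \<le> integral {0..L} (\<lambda>t. h t powr p)"
proof -
  have ptw: "(h t)\<^sup>2 \<le> m / 2 + (m / 2) powr (1 - p / 2) * h t powr p" for t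
  proof (cases "(h t)\<^sup>2 \<le> m / 2")
    case False
    then have ht: "h t > 0" using h(2)[of t] m by (cases "h t = 0") auto
    have "(h t)\<^sup>2 = ((h t)\<^sup>2) powr (1 - p / 2) * ((h t)\<^sup>2) powr (p / 2)"
      using ht by (simp add: powr_add[symmetric])
    also have "((h t)\<^sup>2) powr (p / 2) = h t powr p"
      using ht by (simp flip: powr_numeral add: powr_powr)
    \<comment> \<open>The exponent is nonpositive, so the inequality
      \<open>m / 2 < (h t)\<^sup>2\<close> is reversed.\<close>
    also have "((h t)\<^sup>2) powr (1 - p / 2) \<le> (m / 2) powr (1 - p / 2)"
      using False m p by (intro powr_mono2') auto
    finally show ?thesis using m by (simp add: add_increasing mult_right_mono)
  qed (use m in \<open>simp add: add_increasing2\<close>)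
  have "L * m \<le> integral {0..L} (\<lambda>t. (h t)\<^sup>2)" by (rule integral_square_ge)
  also have "\<dots> \<le> integral {0..L} (\<lambda>t. m / 2 + (m / 2) powr (1 - p / 2) * h t powr p)"
    using ptw integrable_powr[of p] p
    by (intro integral_le integrable_square integrable_add integrable_on_mult_right) auto
  also have "\<dots> = L * m / 2 + (m / 2) powr (1 - p / 2) * integral {0..L} (\<lambda>t. h t powr p)"
    using integrable_powr[of p] p L
    by (subst integral_add) (auto intro!: integrable_on_mult_right)
  finally have "L * m / 2 \<le> (m / 2) powr (1 - p / 2) * integral {0..L} (\<lambda>t. h t powr p)"
    by simp
  moreover have "(m / 2) powr (1 - p / 2) = (m / 2) / (m / 2) powr (p / 2)"
    using m by (simp add: powr_diff)
  ultimately have "m / 2 * L \<le> m / 2 * (integral {0..L} (\<lambda>t. h t powr p) / (m / 2) powr (p / 2))"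
    by (simp add: mult_ac)
  then have "L \<le> integral {0..L} (\<lambda>t. h t powr p) / (m / 2) powr (p / 2)"
    using m by (subst (asm) mult_le_cancel_left_pos) auto
  then show ?thesis
    using m by (simp add: pos_le_divide_eq)
qed

lemma bound_ge_sqrt:
  assumes L: "L > 0" and B: "\<And>t. h t \<le> B"
  shows "sqrt m \<le> B"
proof -
  have "L * m \<le> integral {0..L} (\<lambda>t. (h t)\<^sup>2)" by (rule integral_square_ge)
  also have "\<dots> \<le> integral {0..L} (\<lambda>t. B\<^sup>2)"
    using B h(2) by (intro integral_le integrable_square) (auto intro: power_mono)
  also have "\<dots> = L * B\<^sup>2" using L by simp
  finally have "m \<le> B\<^sup>2" using L by simp
  moreover have "B \<ge> 0" using B[of 0] h(2)[of 0] by linarith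
  ultimately show ?thesis by (simp add: real_le_lsqrt)
qed

end

text \<open>Three ranges of \<open>p\<close> are treated: up to 2, finite above 2, and infinite. The
  factor \<open>1 / 2\<close> is the constant of the first range; the other two give
  \<open>1 / sqrt 2\<close> and \<open>1\<close>, which are weakened to it.\<close>

lemma integral_mean_ge:
  assumes f: "f holomorphic_on UNIV" and r: "r > 0" and F: "finite F" "F \<noteq> {}"
    and \<kappa>: "\<kappa> > 0" and p: "1 \<le> p"
    and coeff: "\<And>n. n \<in> F \<Longrightarrow> \<kappa> \<le> cmod (fps_expansion f 0 $ n) * r ^ n"
  shows "\<kappa> / 2 * real (card F) powr (1 - 1 / real_of_ereal (min 2 p)) \<le> integral_mean p f r"
proof -
  define m where "m = real (card F)"
  have m: "m > 0" using F by (simp add: m_def card_gt_0_iff)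
  have contf: "continuous_on {0..2 * pi} (\<lambda>t. f (of_real r * cis t))"
    by (rule continuous_on_compose2[OF holomorphic_on_imp_continuous_on[OF f]])
      (auto intro!: continuous_intros)
  \<comment> \<open>Dividing by \<open>\<kappa>\<close> normalises the dual estimate to the form
    required by \<open>prod\<close>.\<close>
  define h where "h t = cmod (f (of_real r * cis t)) / \<kappa>" for t
  have h: "continuous_on {0..2 * pi} h"
    unfolding h_def by (intro continuous_intros contf) (use \<kappa> in auto)
  have h0: "0 \<le> h t" for t
    using \<kappa> by (simp add: h_def)
  obtain u where "continuous_on {0..2 * pi} u" "\<And>t. 0 \<le> u t" "\<And>t. u t \<le> real (card F)"
    "((\<lambda>t. (u t)\<^sup>2) has_integral 2 * pi * real (card F)) {0..2 * pi}"
    "2 * pi * (\<kappa> * real (card F)) \<le>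
      integral {0..2 * pi} (\<lambda>t. cmod (f (of_real r * cis t)) * u t)"
    by (rule obtain_dual_function[OF f r F(1)], erule coeff) (rule that)
  note u = this[folded m_def]
  have prod: "2 * pi * m \<le> integral {0..2 * pi} (\<lambda>t. h t * u t)"
    using u(5) \<kappa> by (simp add: h_def field_simps)
  note ctx = h h0 u(1-3) m u(4) prod
  show ?thesis
  proof (cases "p = \<infinity>")
    case True
    have bdd: "bdd_above ((\<lambda>z. cmod (f z)) ` sphere 0 r)"
      using holomorphic_on_subset[OF f subset_UNIV]
      by (intro compact_imp_bounded[THEN bounded_imp_bdd_above] compact_continuous_image
          continuous_intros holomorphic_on_imp_continuous_on) auto
    have "h t \<le> integral_mean p f r / \<kappa>" for t
      unfolding h_def integral_mean_def using True \<kappa> r bdd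
      by (auto intro!: divide_right_mono cSUP_upper simp: norm_mult)
    then have "sqrt m \<le> integral_mean p f r / \<kappa>"
      by (intro bound_ge_sqrt[OF ctx]) auto
    then have "\<kappa> * sqrt m \<le> integral_mean p f r" using \<kappa> by (simp add: field_simps)
    moreover have "\<kappa> / 2 * sqrt m \<le> \<kappa> * sqrt m" using \<kappa> m by simp
    ultimately have "\<kappa> / 2 * sqrt m \<le> integral_mean p f r" by linarith
    then show ?thesis using True m by (simp add: m_def powr_half_sqrt)
  next
    case False
    then obtain q where q: "p = ereal q" "q \<ge> 1"
      using p by (cases p) auto
    have hq: "h t powr q = cmod (f (of_real r * cis t)) powr q / \<kappa> powr q" for t
      using \<kappa> by (simp add: h_def powr_divide)
    have M: "integral_mean p f r =
        \<kappa> * (1 / (2 * pi) * integral {0..2 * pi} (\<lambda>t. h t powr q)) powr (1 / q)"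
    proof -
      have "integral {0..2 * pi} (\<lambda>t. cmod (f (of_real r * cis t)) powr q) =
          \<kappa> powr q * integral {0..2 * pi} (\<lambda>t. h t powr q)"
        unfolding hq using \<kappa> by simp
      moreover have "0 \<le> integral {0..2 * pi} (\<lambda>t. h t powr q)"
        using integrable_powr[OF ctx, of q] q by (intro integral_nonneg) auto
      ultimately show ?thesis
        using q \<kappa> False by (simp add: integral_mean_def cis_conv_exp powr_mult powr_powr powr_divide)
    qed
    have key: "\<kappa> * X powr (1 / q) \<le> integral_mean p f r"
      if "2 * pi * X \<le> integral {0..2 * pi} (\<lambda>t. h t powr q)" "X \<ge> 0" for X
      unfolding M using \<kappa> that q by (intro mult_left_mono powr_mono2) (auto simp: field_simps)
    show ?thesis
    proof (cases "q \<le> 2")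
      case True
      have "\<kappa> * (m powr (q - 1) / 2 powr q) powr (1 / q) \<le> integral_mean p f r"
        using integral_powr_ge_small[OF ctx q(2) True] by (intro key) auto
      moreover have "(m powr (q - 1) / 2 powr q) powr (1 / q) = m powr (1 - 1 / q) / 2"
        using q by (simp add: powr_divide powr_powr diff_divide_distrib)
      moreover have "real_of_ereal (min 2 p) = q"
        using True q by (simp add: min_def)
      ultimately have "\<kappa> * (m powr (1 - 1 / real_of_ereal (min 2 p)) / 2) \<le> integral_mean p f r"
        by (simp only:)
      then show ?thesis by (simp add: m_def)
    next
      case False
      have "\<kappa> * ((m / 2) powr (q / 2)) powr (1 / q) \<le> integral_mean p f r"
        using integral_powr_ge_large[OF ctx, of q] False by (intro key) auto
      then have bound: "\<kappa> * (sqrt m / sqrt 2) \<le> integral_mean p f r"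
        using q m by (simp add: powr_powr powr_half_sqrt real_sqrt_divide)
      have "sqrt m / 2 \<le> sqrt m / sqrt 2"
        using m sqrt2_less_2 by (intro divide_left_mono) auto
      then have le: "\<kappa> * (sqrt m / 2) \<le> \<kappa> * (sqrt m / sqrt 2)"
        using \<kappa> by (intro mult_left_mono) auto
      have "\<kappa> * (sqrt m / 2) \<le> integral_mean p f r"
        using le bound by linarith
      moreover have "real_of_ereal (min 2 p) = 2"
        using False q by (simp add: min_def)
      ultimately show ?thesis using m by (simp add: m_def powr_half_sqrt)
    qed
  qed
qed

section \<open>Lower density and windows\<close>

lemma lower_density_posE:
  assumes "lower_density A > 0"
  obtains d where "d > 0" "d \<le> 1" "\<forall>\<^sub>F N in sequentially. d * real N \<le> real (card (A \<inter> {1..N}))"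
proof -
  obtain x where x: "0 < ereal x" "ereal x < lower_density A"
    using ereal_dense2[OF assms] by blast
  have "\<forall>\<^sub>F N in sequentially. ereal (real (card (A \<inter> {1..N})) / real N) > ereal x"
    using less_LiminfD[OF x(2)[unfolded lower_density_def]] .
  then have "\<forall>\<^sub>F N in sequentially. min x 1 * real N \<le> real (card (A \<inter> {1..N}))"
    using eventually_gt_at_top[of 0]
  proof eventually_elim
    case (elim N)
    then have "x * real N \<le> real (card (A \<inter> {1..N}))"
      by (simp add: field_simps)
    moreover have "min x 1 * real N \<le> x * real N" by (intro mult_right_mono) auto
    ultimately show ?case by linarith
  qed
  then show ?thesis using x(1) by (intro that[of "min x 1"]) auto
qed

text \<open>Pigeonhole over \<open>k\<close> consecutive blocks of length \<open>k\<close>. If every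
  block with index at least \<open>d * k / 4\<close> were sparse, the initial blocks would hold at
  most \<open>(d * k / 4 + 1) * k\<close> elements and the sparse bound would add at most
  \<open>d * k\<^sup>2 / 4\<close>; the total is less than \<open>d * k\<^sup>2\<close> once
  \<open>k > 2 / d\<close>. Discarding the initial blocks makes \<open>s\<close> of order
  \<open>k\<^sup>2\<close>.\<close>

lemma dense_window:
  fixes d :: real
  assumes d: "d > 0" "d \<le> 1" and dens: "d * real (k\<^sup>2) \<le> real (card (A \<inter> {1..k\<^sup>2}))"
    and k: "real k > 2 / d"
  obtains s where "d / 4 * (real k)\<^sup>2 \<le> real s" "d / 4 * real k \<le> real (card (A \<inter> {s<..s + k}))"
    "s \<le> k\<^sup>2"
proof -
  define c where "c = d / 4"
  define B where "B i = A \<inter> {i * k<..i * k + k}" for i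
  have c: "c > 0" using d by (simp add: c_def)
  have "k > 0" using k d by (metis divide_pos_pos less_trans of_nat_0_less_iff zero_less_numeral)
  have "\<exists>i<k. c * real k \<le> real i \<and> c * real k \<le> real (card (B i))"
  proof (rule ccontr)
    assume neg: "\<not> ?thesis"
    have Bk: "card (B i) \<le> k" for i
      using card_mono[of "{i * k<..i * k + k}" "B i"] by (simp add: B_def)
    \<comment> \<open>Blocks with index below \<open>j\<close> are counted trivially with
      \<open>k\<close> elements each.\<close>
    define j where "j = nat \<lceil>c * real k\<rceil>"
    have j: "c * real k \<le> real j" "real j \<le> c * real k + 1"
      using c by (auto simp: j_def intro: real_nat_ceiling_ge)
    have "A \<inter> {1..k\<^sup>2} \<subseteq> (\<Union>i<k. B i)"
    proof
      fix n assume n: "n \<in> A \<inter> {1..k\<^sup>2}"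
      \<comment> \<open>The blocks are open on the left, so a multiple of \<open>k\<close> belongs
        to the block that ends with it.\<close>
      define i where "i = (n - 1) div k"
      have "i < k" using n \<open>k > 0\<close>
        by (auto simp: i_def power2_eq_square less_mult_imp_div_less)
      moreover have "i * k \<le> n - 1" "n - 1 < i * k + k"
        using \<open>k > 0\<close> dividend_less_div_times[of k "n - 1"] by (auto simp: i_def)
      ultimately show "n \<in> (\<Union>i<k. B i)" using n by (auto simp: B_def intro!: bexI[of _ i])
    qed
    then have "card (A \<inter> {1..k\<^sup>2}) \<le> card (\<Union>i<k. B i)"
      by (intro card_mono) (auto simp: B_def)
    also have "\<dots> \<le> (\<Sum>i<k. card (B i))" by (rule card_UN_le) simp
    finally have "real (card (A \<inter> {1..k\<^sup>2})) \<le> (\<Sum>i<k. real (card (B i)))"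
      by (metis of_nat_le_iff of_nat_sum)
    also have "\<dots> \<le> (\<Sum>i<k. (if i < j then real k else 0) + c * real k)"
    proof (rule sum_mono)
      fix i assume i: "i \<in> {..<k}"
      show "real (card (B i)) \<le> (if i < j then real k else 0) + c * real k"
      proof (cases "i < j")
        case True
        then show ?thesis using Bk[of i] c by (simp add: add_increasing2)
      next
        case False
        then have "c * real k \<le> real i" using j by linarith
        then show ?thesis using neg i False by fastforce
      qed
    qed
    also have "\<dots> = real (card ({..<k} \<inter> {..<j})) * real k + c * real k * real k"
      by (simp add: sum.distrib sum.If_cases lessThan_def)
    also have "\<dots> \<le> real j * real k + c * real k * real k"
      using card_mono[of "{..<j}" "{..<k} \<inter> {..<j}"] by (intro add_right_mono mult_right_mono) auto
    also have "\<dots> \<le> (c * real k + 1) * real k + c * real k * real k"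
      using j by (intro add_right_mono mult_right_mono) auto
    finally have "d * real (k\<^sup>2) \<le> (2 * c * real k + 1) * real k"
      using dens by (simp add: algebra_simps)
    then have "d * real k \<le> 2 * c * real k + 1"
      using \<open>k > 0\<close> by (simp add: power2_eq_square mult.assoc[symmetric])
    then show False using k d by (simp add: c_def field_simps)
  qed
  then obtain i where i: "i < k" "c * real k \<le> real i" "c * real k \<le> real (card (B i))" by blast
  show ?thesis
  proof
    show "d / 4 * (real k)\<^sup>2 \<le> real (i * k)"
      using mult_right_mono[OF i(2), of "real k"] by (simp add: c_def power2_eq_square mult_ac)
    show "d / 4 * real k \<le> real (card (A \<inter> {i * k<..i * k + k}))"
      using i(3) by (simp add: B_def c_def)
    show "i * k \<le> k\<^sup>2" using i(1) by (simp add: power2_eq_square)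
  qed
qed

section \<open>From frequent hypercyclicity to growth\<close>

lemma frequently_hypercyclic_coeff_density:
  assumes f: "f holomorphic_on UNIV"
    and fhc: "frequently_hypercyclic entire_topology (dunkl \<alpha>) f"
  shows "lower_density {n. n \<ge> 1 \<and> cmod (of_real (dunkl_fact \<alpha> n) * fps_expansion f 0 $ n) > 1} > 0"
proof -
  \<comment> \<open>Evaluation at the origin is continuous, and on the \<open>n\<close>-th iterate
    it reads off the \<open>n\<close>-th coefficient times
    \<open>dunkl_fact \<alpha> n\<close>.\<close>
  define U where "U = {g \<in> entire_functions. cmod (g 0) > 1}"
  have "openin entire_topology U"
    unfolding openin_entire_topology
  proof (intro conjI ballI)
    fix g assume g: "g \<in> U"
    have "{k \<in> entire_functions. \<forall>z\<in>{0}. dist (k z) (g z) < cmod (g 0) - 1} \<subseteq> U"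
    proof safe
      fix k assume "k \<in> entire_functions" "\<forall>z\<in>{0}. dist (k z) (g z) < cmod (g 0) - 1"
      then show "k \<in> U"
        using norm_triangle_ineq2[of "g 0" "k 0"] by (simp add: U_def dist_norm norm_minus_commute)
    qed
    then show "\<exists>K \<epsilon>. compact K \<and> \<epsilon> > 0 \<and> {k \<in> entire_functions. \<forall>z\<in>K. dist (k z) (g z) < \<epsilon>} \<subseteq> U"
      using g by (intro exI[of _ "{0}"] exI[of _ "cmod (g 0) - 1"]) (auto simp: U_def)
  qed (auto simp: U_def)
  moreover have "(\<lambda>_. 2) \<in> U" by (simp add: U_def entire_functions_def)
  ultimately have "lower_density {n. n \<ge> 1 \<and> (dunkl \<alpha> ^^ n) f \<in> U} > 0"
    using fhc unfolding frequently_hypercyclic_def by blast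
  then show ?thesis
    by (simp add: U_def entire_functions_def dunkl_funpow_entire[OF f] dunkl_funpow_0[OF f])
qed

text \<open>With \<open>k\<^sup>2\<close> of the order of \<open>s\<close>, the terms \<open>s\<^sup>n / b\<^sub>n\<close> with \<open>n\<close> in
  the window \<open>{s<..s + k}\<close> are all at least of the order \<open>exp s / s powr (\<alpha> + 1)\<close>.\<close>

lemma integral_mean_ge_window:
  assumes \<alpha>: "\<alpha> > - 1 / 2" and p: "1 \<le> p" and f: "f holomorphic_on UNIV"
    and d: "0 < d" and s: "s \<ge> 1" "d * (real k)\<^sup>2 \<le> real s" "s \<le> k\<^sup>2"
    and F: "F \<subseteq> {s<..s + k}" "d * real k \<le> real (card F)"
    and coeff: "\<And>n. n \<in> F \<Longrightarrow> 1 \<le> dunkl_fact \<alpha> n * cmod (fps_expansion f 0 $ n)"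
  defines "q \<equiv> real_of_ereal (min 2 p)"
  shows "exp (- (2 * \<alpha> + 2) - (2 * \<alpha> + 2) / d) / 2 * d powr (1 - 1 / q) *
    (exp (real s) / real s powr (\<alpha> + 1 / 2 + 1 / (2 * q))) \<le> integral_mean p f (real s)"
proof -
  have "k > 0" using s by (cases k) auto
  have "finite F" by (rule finite_subset[OF F(1)]) simp
  have "F \<noteq> {}" using F(2) d \<open>k > 0\<close> by (auto simp: mult_le_0_iff)
  define C where "C = exp (- (2 * \<alpha> + 2) - (2 * \<alpha> + 2) / d)"
  define \<kappa> where "\<kappa> = C * (exp (real s) / real s powr (\<alpha> + 1))"
  have C: "C > 0" by (simp add: C_def)
  have \<kappa>: "\<kappa> > 0" using C s by (simp add: \<kappa>_def)
  have q: "1 \<le> q"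
    using p by (cases p) (auto simp: q_def min_def)
  have \<kappa>_le: "\<kappa> \<le> cmod (fps_expansion f 0 $ n) * real s ^ n" if n: "n \<in> F" for n
  proof -
    define j where "j = n - s"
    have j: "n = s + j" "1 \<le> j" "j \<le> k" using subsetD[OF F(1) n] by (auto simp: j_def)
    \<comment> \<open>This bounds the exponent from \<open>power_div_dunkl_fact_ge\<close> uniformly
      over the window, through \<open>d * k\<^sup>2 \<le> s\<close>.\<close>
    have "real j * (real j + (2 * \<alpha> + 1)) \<le> real k * (real k + (2 * \<alpha> + 1) * real k)"
      using j \<alpha> \<open>k > 0\<close> mult_left_mono[of 1 "real k" "2 * \<alpha> + 1"]
      by (intro mult_mono add_mono) auto
    also have "\<dots> = (2 * \<alpha> + 2) * (real k)\<^sup>2" by (simp add: power2_eq_square algebra_simps)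
    also have "\<dots> \<le> (2 * \<alpha> + 2) * (real s / d)"
      using s d \<alpha> by (intro mult_left_mono) (auto simp: field_simps)
    finally have "real j * (real j + (2 * \<alpha> + 1)) / real s \<le> (2 * \<alpha> + 2) / d"
      using s d by (simp add: field_simps)
    then have "\<kappa> \<le> exp (- (2 * \<alpha> + 2) - real j * (real j + (2 * \<alpha> + 1)) / real s) *
      (exp (real s) / real s powr (\<alpha> + 1))"
      unfolding \<kappa>_def C_def by (intro mult_right_mono) auto
    also have "\<dots> \<le> real s ^ n / dunkl_fact \<alpha> n"
      unfolding j by (rule power_div_dunkl_fact_ge[OF \<alpha> s(1)])
    also have "\<dots> = (1 / dunkl_fact \<alpha> n) * real s ^ n" by simp
    also have "\<dots> \<le> cmod (fps_expansion f 0 $ n) * real s ^ n"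
      using coeff[OF n] dunkl_fact_pos[OF \<alpha>, of n]
      by (intro mult_right_mono) (auto simp: field_simps)
    finally show ?thesis .
  qed
  \<comment> \<open>Here the upper bound \<open>s \<le> k\<^sup>2\<close> enters: the number of
    frequencies is at least of order \<open>sqrt s\<close>.\<close>
  have "d * sqrt (real s) \<le> d * real k"
    using s d by (intro mult_left_mono real_le_lsqrt) (auto simp flip: of_nat_power)
  then have "d * sqrt (real s) \<le> real (card F)" using F by linarith
  then have "(d * sqrt (real s)) powr (1 - 1 / q) \<le> real (card F) powr (1 - 1 / q)"
    using d q by (intro powr_mono2) auto
  then have "\<kappa> / 2 * (d * sqrt (real s)) powr (1 - 1 / q) \<le> \<kappa> / 2 * real (card F) powr (1 - 1 / q)"
    using \<kappa> by (intro mult_left_mono) auto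
  also have "\<dots> \<le> integral_mean p f (real s)"
    unfolding q_def using s \<open>finite F\<close> \<open>F \<noteq> {}\<close> \<kappa> p \<kappa>_le
    by (intro integral_mean_ge[OF f]) auto
  also have "\<kappa> / 2 * (d * sqrt (real s)) powr (1 - 1 / q) =
    C / 2 * d powr (1 - 1 / q) *
      (exp (real s) * (sqrt (real s) powr (1 - 1 / q) / real s powr (\<alpha> + 1)))"
    using d by (simp add: \<kappa>_def powr_mult mult_ac)
  also have "sqrt (real s) powr (1 - 1 / q) = real s powr ((1 - 1 / q) / 2)"
    by (simp only: powr_half_sqrt[OF of_nat_0_le_iff, symmetric] powr_powr times_divide_eq_left mult_1)
  also have "\<dots> / real s powr (\<alpha> + 1) = real s powr ((1 - 1 / q) / 2 - (\<alpha> + 1))"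
    by (rule powr_diff[symmetric])
  \<comment> \<open>The critical exponent emerges: the factorial costs \<open>\<alpha> + 1\<close>,
    and about \<open>sqrt s\<close> frequencies win back \<open>(1 - 1 / q) / 2\<close>.\<close>
  also have "(1 - 1 / q) / 2 - (\<alpha> + 1) = - (\<alpha> + 1 / 2 + 1 / (2 * q))"
    by (simp add: field_simps)
  also have "exp (real s) * real s powr - (\<alpha> + 1 / 2 + 1 / (2 * q)) =
      exp (real s) / real s powr (\<alpha> + 1 / 2 + 1 / (2 * q))"
    by (simp only: powr_minus divide_inverse)
  finally show ?thesis unfolding C_def .
qed

theorem theorem6:
  fixes \<alpha> a :: real and p :: ereal and \<psi> :: "real \<Rightarrow> real"
  assumes "\<alpha> > - 1 / 2"
    and "1 \<le> p"
    and "a = \<alpha> + 1 / 2 + 1 / (2 * real_of_ereal (min 2 p))"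
    and "\<And>r. r > 0 \<Longrightarrow> \<psi> r > 0"
    and "(\<psi> \<longlongrightarrow> 0) at_top"
  shows "\<not> (\<exists>f. f holomorphic_on UNIV
             \<and> frequently_hypercyclic entire_topology (dunkl \<alpha>) f
             \<and> (\<forall>\<^sub>F r in at_top. integral_mean p f r \<le> \<psi> r * (exp r / r powr a)))"
proof
  assume "\<exists>f. f holomorphic_on UNIV
             \<and> frequently_hypercyclic entire_topology (dunkl \<alpha>) f
             \<and> (\<forall>\<^sub>F r in at_top. integral_mean p f r \<le> \<psi> r * (exp r / r powr a))"
  then obtain f where f: "f holomorphic_on UNIV"
    and fhc: "frequently_hypercyclic entire_topology (dunkl \<alpha>) f"
    and growth: "\<forall>\<^sub>F r in at_top. integral_mean p f r \<le> \<psi> r * (exp r / r powr a)"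
    by blast
  define A where "A = {n. n \<ge> 1 \<and> cmod (of_real (dunkl_fact \<alpha> n) * fps_expansion f 0 $ n) > 1}"
  have coeff: "1 \<le> dunkl_fact \<alpha> n * cmod (fps_expansion f 0 $ n)" if "n \<in> A" for n
    using that dunkl_fact_pos[OF assms(1), of n] by (simp add: A_def norm_mult)
  obtain d where d: "d > 0" "d \<le> 1"
    and dens: "\<forall>\<^sub>F N in sequentially. d * real N \<le> real (card (A \<inter> {1..N}))"
    using lower_density_posE[OF frequently_hypercyclic_coeff_density[OF f fhc]]
    unfolding A_def by blast
  define c where "c = d / 4"
  have c: "c > 0" using d by (simp add: c_def)
  \<comment> \<open>The constant of \<open>integral_mean_ge_window\<close> for the window density
    \<open>c\<close>; it depends on neither \<open>k\<close> nor \<open>s\<close>, so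
    \<open>\<psi>\<close> eventually falls below it.\<close>
  define C where "C = exp (- (2 * \<alpha> + 2) - (2 * \<alpha> + 2) / c) / 2 *
    c powr (1 - 1 / real_of_ereal (min 2 p))"
  have C: "C > 0" using c by (simp add: C_def)
  have "\<forall>\<^sub>F r in at_top. \<psi> r < C"
    by (rule order_tendstoD(2)[OF assms(5) C])
  then have "\<forall>\<^sub>F r in at_top. r \<ge> 1 \<and> \<psi> r < C \<and> integral_mean p f r \<le> \<psi> r * (exp r / r powr a)"
    using growth eventually_ge_at_top[of "1::real"] by eventually_elim auto
  then obtain R where R: "\<And>r. r \<ge> R \<Longrightarrow>
      r \<ge> 1 \<and> \<psi> r < C \<and> integral_mean p f r \<le> \<psi> r * (exp r / r powr a)"
    unfolding eventually_at_top_linorder by blast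
  have sq: "filterlim (\<lambda>k::nat. k\<^sup>2) sequentially sequentially"
    by (rule filterlim_at_top_mono[OF filterlim_ident]) (simp add: power2_nat_le_imp_le power2_eq_square)
  \<comment> \<open>The density bound is used along the squares only, matching the \<open>k\<close>
    blocks of length \<open>k\<close>.\<close>
  have "\<forall>\<^sub>F k in sequentially. d * real (k\<^sup>2) \<le> real (card (A \<inter> {1..k\<^sup>2}))"
    using eventually_compose_filterlim[OF dens sq] .
  moreover have "\<forall>\<^sub>F k in sequentially. real k > 2 / d"
    using filterlim_real_sequentially by (simp add: filterlim_at_top_dense)
  moreover have "\<forall>\<^sub>F k in sequentially. real k > \<bar>R\<bar> / c"
    using filterlim_real_sequentially by (simp add: filterlim_at_top_dense)
  ultimately have "\<forall>\<^sub>F k in sequentially. d * real (k\<^sup>2) \<le> real (card (A \<inter> {1..k\<^sup>2})) \<and>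
      real k > 2 / d \<and> real k > \<bar>R\<bar> / c"
    by eventually_elim simp
  then obtain k where k: "d * real (k\<^sup>2) \<le> real (card (A \<inter> {1..k\<^sup>2}))" "real k > 2 / d"
      "real k > \<bar>R\<bar> / c"
    using eventually_happens'[OF sequentially_bot] by blast
  obtain s where s: "c * (real k)\<^sup>2 \<le> real s" "c * real k \<le> real (card (A \<inter> {s<..s + k}))" "s \<le> k\<^sup>2"
    using dense_window[OF d k(1,2)] unfolding c_def by blast
  have "1 \<le> real k" using k(2) d by (cases k) (auto simp: field_simps)
  \<comment> \<open>Since \<open>s\<close> is at least \<open>c * k\<^sup>2\<close>, this pushes
    \<open>s\<close> into the range where the growth assumption and \<open>\<psi> s < C\<close> both
    hold.\<close>
  have "R \<le> c * real k" using k(3) c by (simp add: field_simps)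
  also have "\<dots> \<le> c * (real k)\<^sup>2"
    using \<open>1 \<le> real k\<close> c by (intro mult_left_mono) (auto simp: power2_eq_square)
  finally have Rs: "R \<le> real s" using s(1) by linarith
  have s1: "s \<ge> 1" using R[OF Rs] by simp
  have "C * (exp (real s) / real s powr a) \<le> integral_mean p f (real s)"
    unfolding C_def assms(3)
    using integral_mean_ge_window[OF assms(1,2) f c s1 s(1,3) _ s(2)] coeff by blast
  also have "\<dots> \<le> \<psi> (real s) * (exp (real s) / real s powr a)" using R[OF Rs] by blast
  also have "\<dots> < C * (exp (real s) / real s powr a)"
    using R[OF Rs] by (intro mult_strict_right_mono) auto
  finally show False by simp
qed

end
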